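(* Let $M_6$ be the simple graph on $6$ vertices whose complement is the disjoint union of two paths on $3$ vertices each (so $M_6$ has $11$ edges). Then $M_6$ is a smallest non-autograph: $M_6$ is not an autograph, while every simple graph with at most $5$ vertices is an autograph.
   Context: Let $G=(V,E)$ be a finite simple graph and $S$ a finite multiset of integers. $G$ is an autograph with signature $S$ if there is a bijection $\pi$ from the elements of $S$ (counted with multiplicity) to $V$ such that for any two distinct elements $s,t$ of $S$, the vertices $\pi(s),\pi(t)$ are adjacent if and only if $|s-t|\in S$. A graph is a non-autograph if it admits no signature. *)

theory Defs
  imports "HOL-Library.Multiset"
begin

definition simple_graph :: "'a set \<Rightarrow> 'a set set \<Rightarrow> bool" where
  "simple_graph V E \<longleftrightarrow> finite V \<and> (\<forall>e\<in>E. e \<subseteq> V \<and> card e = 2)"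

definition graph_complement :: "'a set \<Rightarrow> 'a set set \<Rightarrow> 'a set set" where
  "graph_complement V E = {e. e \<subseteq> V \<and> card e = 2 \<and> e \<notin> E}"

definition is_path :: "nat \<Rightarrow> 'a set \<Rightarrow> 'a set set \<Rightarrow> bool" where
  "is_path n V E \<longleftrightarrow>
    (\<exists>p. bij_betw p {..<n} V \<and> E = {{p i, p (Suc i)} | i. Suc i < n})"

definition is_M6 :: "'a set \<Rightarrow> 'a set set \<Rightarrow> bool" where
  "is_M6 V E \<longleftrightarrow> simple_graph V E \<and> card V = 6 \<and>
    (\<exists>V1 E1 V2 E2. V1 \<inter> V2 = {} \<and> V = V1 \<union> V2 \<and> graph_complement V E = E1 \<union> E2 \<and>
       is_path 3 V1 E1 \<and> is_path 3 V2 E2)"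

text \<open>The elements of a multiset counted with multiplicity: the pair \<open>(s, i)\<close> is the
  \<open>i\<close>-th copy of \<open>s\<close>. Two different copies of the same integer are therefore distinct
  elements, and their difference is \<open>0\<close>.\<close>

definition mset_elements :: "'a multiset \<Rightarrow> ('a \<times> nat) set" where
  "mset_elements S = {(s, i). i < count S s}"

definition is_signature :: "int multiset \<Rightarrow> 'a set \<Rightarrow> 'a set set \<Rightarrow> bool" where
  "is_signature S V E \<longleftrightarrow>
    (\<exists>\<pi>. bij_betw \<pi> (mset_elements S) V \<and>
      (\<forall>x\<in>mset_elements S. \<forall>y\<in>mset_elements S. x \<noteq> y \<longrightarrow>
         ({\<pi> x, \<pi> y} \<in> E \<longleftrightarrow> \<bar>fst x - fst y\<bar> \<in># S)))"

definition autograph :: "'a set \<Rightarrow> 'a set set \<Rightarrow> bool" where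
  "autograph V E \<longleftrightarrow> (\<exists>S. is_signature S V E)"

lemma is_M6_exists: "\<exists>(V :: nat set) E. is_M6 V E"
proof -
  define V1 V2 :: "nat set" where "V1 = {0, 1, 2}" and "V2 = {3, 4, 5}"
  define C1 C2 :: "nat set set" where "C1 = {{0, 1}, {1, 2}}" and "C2 = {{3, 4}, {4, 5}}"
  define V where "V = V1 \<union> V2"
  define E where "E = {e. e \<subseteq> V \<and> card e = 2 \<and> e \<notin> C1 \<union> C2}"
  have V: "V1 \<inter> V2 = {}" "card V = 6" "finite V"
    by (simp_all add: V_def V1_def V2_def)
  have C: "\<forall>e \<in> C1 \<union> C2. e \<subseteq> V \<and> card e = 2"
    by (simp add: C1_def C2_def V_def V1_def V2_def)
  have 1: "simple_graph V E"
    unfolding simple_graph_def E_def using V by blast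
  have 2: "graph_complement V E = C1 \<union> C2"
    unfolding graph_complement_def E_def using C by blast
  have i: "{f i | i. Suc i < 3} = {f 0, f 1}" for f :: "nat \<Rightarrow> nat set"
  proof -
    have "Suc i < 3 \<longleftrightarrow> i = 0 \<or> i = 1" for i
      by auto
    then show ?thesis
      by (simp only:) auto
  qed
  have s: "{..<3} = {0, 1, 2 :: nat}"
    by auto
  have 3: "is_path 3 V1 C1"
    unfolding is_path_def i s V1_def C1_def
    by (rule exI[of _ "\<lambda>i. i"]) (simp add: bij_betw_def numeral_2_eq_2)
  have 4: "is_path 3 V2 C2"
    unfolding is_path_def i s V2_def C2_def
    by (rule exI[of _ "\<lambda>i. i + 3"]) (simp add: bij_betw_def inj_on_def)
  show ?thesis
    unfolding is_M6_def using 1 2 3 4 V V_def by blast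
qed

end

theory Submission
  imports Defs "HOL-Combinatorics.Transposition"
begin

text \<open>
  A signature is the same as an integer labelling of the vertices in which two vertices are adjacent
  iff the distance of their labels is again a label.

  \<open>M\<^sub>6\<close> is excluded by looking at a vertex with the largest label \<open>m\<close>: the reflection \<open>x \<mapsto> m - x\<close>
  preserves distances, it maps the labels of the neighbours of that vertex to labels, and it cannot
  produce the label of a non-neighbour. Apart from the case where \<open>0\<close> is a label, it permutes the
  neighbours, and this conflicts with the non-edges among them, unless the vertex is the middle of one
  of the two paths and the other path is labelled by an arithmetic progression
  \<open>m/2 - k, m/2, m/2 + k\<close>; there the two remaining labels are left with finitely many linear systems,
  none of which is solvable.

  For the small graphs one numbers the vertices such that the sum of \<open>i j\<close> over all edges \<open>{i, j}\<close> is
  maximal. Only 59 graphs on \<open>{1, \<dots>, n}\<close> with \<open>n \<le> 5\<close> do not admit a transposition which increases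
  this sum, and each of them has an explicit signature.
\<close>

section \<open>Signatures as vertex labellings\<close>

text \<open>The fibre of \<open>x\<close> over \<open>s\<close> has as many vertices as
  \<open>s\<close> has copies in the multiset of labels. Numbering each fibre matches the copies of
  \<open>s\<close> with its vertices.\<close>

lemma bij_betw_mset_elements_image_mset:
  assumes "finite V"
  obtains \<pi> where "bij_betw \<pi> (mset_elements (image_mset x (mset_set V))) V"
    and "\<And>p. p \<in> mset_elements (image_mset x (mset_set V)) \<Longrightarrow> x (\<pi> p) = fst p"
proof -
  let ?S = "image_mset x (mset_set V)"
  define fib where "fib s = {v \<in> V. x v = s}" for s
  have count: "count ?S s = card (fib s)" for s
    using assms by (simp add: fib_def count_image_mset Int_def vimage_def conj_commute)
  have "\<exists>h. bij_betw h {0..<card (fib s)} (fib s)" for s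
    using assms by (intro ex_bij_betw_nat_finite) (simp add: fib_def)
  then obtain h where h: "bij_betw (h s) {0..<card (fib s)} (fib s)" for s
    by metis
  define \<pi> where "\<pi> = (\<lambda>(s, i). h s i)"
  have h_mem: "h s i \<in> fib s" if "i < card (fib s)" for s i
    using bij_betwE[OF h[of s]] that by simp
  have mem: "\<pi> p \<in> V \<and> x (\<pi> p) = fst p" if "p \<in> mset_elements ?S" for p
    using that h_mem by (auto simp: mset_elements_def count \<pi>_def fib_def)
  have "inj_on \<pi> (mset_elements ?S)"
  proof (rule inj_onI)
    fix p q assume p: "p \<in> mset_elements ?S" and q: "q \<in> mset_elements ?S" and "\<pi> p = \<pi> q"
    obtain s i t j where [simp]: "p = (s, i)" "q = (t, j)" by fastforce
    have "s = t" using mem[OF p] mem[OF q] \<open>\<pi> p = \<pi> q\<close> by simp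
    moreover have "i = j"
      using p q \<open>\<pi> p = \<pi> q\<close> \<open>s = t\<close> bij_betw_imp_inj_on[OF h[of s]]
      by (auto simp: mset_elements_def count \<pi>_def inj_on_def)
    ultimately show "p = q" by simp
  qed
  moreover have "v \<in> \<pi> ` mset_elements ?S" if "v \<in> V" for v
  proof -
    have "v \<in> h (x v) ` {0..<card (fib (x v))}"
      using bij_betw_imp_surj_on[OF h[of "x v"]] that by (simp add: fib_def)
    then obtain i where "i < card (fib (x v))" "v = h (x v) i"
      by auto
    then have "(x v, i) \<in> mset_elements ?S" "v = \<pi> (x v, i)"
      by (simp_all add: mset_elements_def count \<pi>_def)
    then show ?thesis by blast
  qed
  ultimately have "bij_betw \<pi> (mset_elements ?S) V"
    using mem by (auto simp: bij_betw_def)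
  with that mem show ?thesis by blast
qed

text \<open>From a signature, each vertex takes the integer whose copy is sent to it by
  \<open>\<pi>\<close>. From a labelling, the multiset of all labels is the signature.\<close>

lemma autograph_iff_labelling:
  assumes "finite V"
  shows "autograph V E \<longleftrightarrow>
    (\<exists>x :: 'a \<Rightarrow> int. \<forall>u\<in>V. \<forall>v\<in>V. u \<noteq> v \<longrightarrow> ({u, v} \<in> E \<longleftrightarrow> \<bar>x u - x v\<bar> \<in> x ` V))"
proof
  assume "autograph V E"
  then obtain S :: "int multiset" and \<pi> where bij: "bij_betw \<pi> (mset_elements S) V"
    and adj: "\<And>p q. p \<in> mset_elements S \<Longrightarrow> q \<in> mset_elements S \<Longrightarrow> p \<noteq> q \<Longrightarrow>
      {\<pi> p, \<pi> q} \<in> E \<longleftrightarrow> \<bar>fst p - fst q\<bar> \<in># S"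
    unfolding autograph_def is_signature_def by blast
  define \<rho> where "\<rho> = inv_into (mset_elements S) \<pi>"
  have \<rho>: "bij_betw \<rho> V (mset_elements S)"
    unfolding \<rho>_def using bij by (rule bij_betw_inv_into)
  have \<pi>\<rho>: "\<pi> (\<rho> v) = v" if "v \<in> V" for v
    unfolding \<rho>_def using bij that by (rule bij_betw_inv_into_right)
  have "fst ` mset_elements S = set_mset S"
  proof (intro equalityI subsetI)
    fix s assume "s \<in># S"
    then have "(s, 0) \<in> mset_elements S"
      by (simp add: mset_elements_def)
    then show "s \<in> fst ` mset_elements S"
      by force
  qed (auto simp: mset_elements_def simp flip: count_greater_zero_iff)
  then have "(fst \<circ> \<rho>) ` V = set_mset S"
    unfolding image_comp[symmetric] bij_betw_imp_surj_on[OF \<rho>] .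
  moreover have "{u, v} \<in> E \<longleftrightarrow> \<bar>fst (\<rho> u) - fst (\<rho> v)\<bar> \<in># S"
    if "u \<in> V" "v \<in> V" "u \<noteq> v" for u v
  proof -
    have "\<rho> u \<in> mset_elements S" "\<rho> v \<in> mset_elements S" "\<rho> u \<noteq> \<rho> v"
      using bij_betwE[OF \<rho>] \<pi>\<rho>[of u] \<pi>\<rho>[of v] that by auto
    from adj[OF this] show ?thesis
      by (simp add: \<pi>\<rho> that)
  qed
  ultimately show "\<exists>x :: 'a \<Rightarrow> int. \<forall>u\<in>V. \<forall>v\<in>V. u \<noteq> v \<longrightarrow> ({u, v} \<in> E \<longleftrightarrow> \<bar>x u - x v\<bar> \<in> x ` V)"
    by (intro exI[of _ "fst \<circ> \<rho>"]) simp
next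
  assume "\<exists>x :: 'a \<Rightarrow> int. \<forall>u\<in>V. \<forall>v\<in>V. u \<noteq> v \<longrightarrow> ({u, v} \<in> E \<longleftrightarrow> \<bar>x u - x v\<bar> \<in> x ` V)"
  then obtain x :: "'a \<Rightarrow> int" where
    x: "\<And>u v. u \<in> V \<Longrightarrow> v \<in> V \<Longrightarrow> u \<noteq> v \<Longrightarrow> {u, v} \<in> E \<longleftrightarrow> \<bar>x u - x v\<bar> \<in> x ` V"
    by blast
  let ?S = "image_mset x (mset_set V)"
  obtain \<pi> where bij: "bij_betw \<pi> (mset_elements ?S) V"
    and \<pi>: "\<And>p. p \<in> mset_elements ?S \<Longrightarrow> x (\<pi> p) = fst p"
    using bij_betw_mset_elements_image_mset[OF assms] by blast
  have "{\<pi> p, \<pi> q} \<in> E \<longleftrightarrow> \<bar>fst p - fst q\<bar> \<in># ?S"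
    if "p \<in> mset_elements ?S" "q \<in> mset_elements ?S" "p \<noteq> q" for p q
  proof -
    have "\<pi> p \<noteq> \<pi> q"
      using bij_betw_imp_inj_on[OF bij] that by (auto dest: inj_onD)
    then show ?thesis
      using x[of "\<pi> p" "\<pi> q"] bij_betwE[OF bij] that \<pi>[of p] \<pi>[of q] assms by simp
  qed
  then show "autograph V E"
    unfolding autograph_def is_signature_def using bij by blast
qed

section \<open>Labellings of \<open>M\<^sub>6\<close>\<close>

text \<open>The paths of the complement are a - b - c and d - e - f, so b and e are the middle
  vertices.\<close>

definition M6_labelling :: "int \<Rightarrow> int \<Rightarrow> int \<Rightarrow> int \<Rightarrow> int \<Rightarrow> int \<Rightarrow> bool" where
  "M6_labelling a b c d e f \<longleftrightarrow> (let S = {a, b, c, d, e, f} in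
     (\<forall>(x, y) \<in> {(a, c), (d, f), (a, d), (a, e), (a, f), (b, d), (b, e), (b, f),
                   (c, d), (c, e), (c, f)}. \<bar>x - y\<bar> \<in> S) \<and>
     (\<forall>(x, y) \<in> {(a, b), (b, c), (d, e), (e, f)}. \<bar>x - y\<bar> \<notin> S))"

text \<open>Together with the exchange of the two paths, this moves a vertex with the largest label
  to the end a or to the middle b.\<close>

lemma M6_labelling_rev: "M6_labelling a b c d e f \<Longrightarrow> M6_labelling c b a d e f"
  unfolding M6_labelling_def Let_def
  by (simp add: abs_minus_commute insert_commute)

lemma M6_labelling_swap: "M6_labelling a b c d e f \<Longrightarrow> M6_labelling d e f a b c"
  unfolding M6_labelling_def Let_def
  by (simp add: abs_minus_commute insert_commute)

lemma M6_labelling_end_not_max: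
  assumes "M6_labelling a b c d e f"
    and max: "b \<le> a" "c \<le> a" "d \<le> a" "e \<le> a" "f \<le> a"
  shows False
proof -
  define S where "S = {a, b, c, d, e, f}"
  have mem: "a \<in> S" "b \<in> S" "c \<in> S" "d \<in> S" "e \<in> S" "f \<in> S"
    by (auto simp: S_def)
  have le: "x \<le> a" if "x \<in> S" for x
    using max that by (auto simp: S_def)
  have adj: "a - c \<in> S" "a - d \<in> S" "a - e \<in> S" "a - f \<in> S" "\<bar>d - f\<bar> \<in> S"
      "\<bar>b - d\<bar> \<in> S" "\<bar>b - e\<bar> \<in> S" "\<bar>b - f\<bar> \<in> S" "\<bar>c - d\<bar> \<in> S" "\<bar>c - e\<bar> \<in> S" "\<bar>c - f\<bar> \<in> S"
    and nadj: "a - b \<notin> S" "\<bar>b - c\<bar> \<notin> S" "\<bar>d - e\<bar> \<notin> S" "\<bar>e - f\<bar> \<notin> S"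
    using assms(1) max unfolding M6_labelling_def Let_def S_def[symmetric] by auto
  have nonneg: "0 \<le> c" "0 \<le> d" "0 \<le> e" "0 \<le> f"
    using adj(1-4)[THEN le] by auto
  \<comment> \<open>If one end of a non-edge is 0, then the distance across it is the other,
    nonnegative label.\<close>
  have nz: "d \<noteq> 0" "e \<noteq> 0" "f \<noteq> 0"
    using nonneg nadj(3,4) mem by auto
  show False
  proof (cases "c = 0")
    case True
    have "0 < - b"
      using True nadj(2) mem by (cases "b < 0") auto
    \<comment> \<open>The distance \<open>y - b\<close> exceeds every label other than a, so it is
      a. Then \<open>- b = a - y\<close> is a label, although it is the distance across the non-edge
      b - c.\<close>
    define y where "y = Max {d, e, f}"
    have y: "y \<in> {d, e, f}" "d \<le> y" "e \<le> y" "f \<le> y"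
      unfolding y_def by (rule Max_in) auto
    have "y - b \<in> S"
      using y(1) adj(6-8) \<open>0 < - b\<close> nonneg by auto
    then have "y - b = a"
      using y \<open>0 < - b\<close> True nonneg by (auto simp: S_def)
    then have "- b \<in> S"
      using y(1) adj(2-4) by (auto simp: algebra_simps)
    then show False
      using nadj(2) True \<open>0 < - b\<close> by simp
  next
    case False
    have "b \<noteq> 0"
      using nadj(1) mem by auto
    then have "0 \<notin> S"
      using False nz nonneg max by (auto simp: S_def)
    \<comment> \<open>Equal labels at d and e would give the edge d - f and the non-edge e - f the
      same distance; e and f are alike. The other pairs are edges, whose distance cannot be
      0.\<close>
    then have ne: "c \<noteq> d" "c \<noteq> e" "c \<noteq> f" "d \<noteq> f" "d \<noteq> e" "e \<noteq> f"
      using adj nadj(3,4) by auto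
    have reflect: "a - x \<in> {c, d, e, f}" if "x \<in> {c, d, e, f}" for x
    proof -
      have "a - x \<in> S" "x \<in> S" "x \<noteq> 0"
        using that adj(1-4) mem False nz by auto
      moreover have "a - x \<noteq> b"
        using nadj(1) \<open>x \<in> S\<close> by auto
      ultimately show ?thesis
        by (simp add: S_def)
    qed
    \<comment> \<open>The reflection is an involution on four distinct numbers with at most one
      fixed point, hence by parity with none: it splits them into two pairs of sum a. Each of the
      three pairings gives an edge and a non-edge the same distance.\<close>
    have "c + d = e + f \<or> c + e = d + f \<or> c + f = d + e"
      using reflect[of c] reflect[of d] reflect[of e] reflect[of f] ne
      unfolding insert_iff empty_iff by (smt (verit))
    then have "\<bar>c - f\<bar> = \<bar>d - e\<bar> \<or> \<bar>c - d\<bar> = \<bar>e - f\<bar>"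
      by auto
    then show False
      using adj(9,11) nadj(3,4) by auto
  qed
qed

text \<open>The case where the middle vertex of one path carries the largest label \<open>2 e\<close>; \<open>a\<close> and \<open>c\<close> are
  the labels of its ends, and \<open>e - k\<close>, \<open>e\<close>, \<open>e + k\<close> those of the other path.\<close>

lemma no_signature_around_midpoint:
  fixes a c e k :: int and S :: "int set"
  assumes S: "S = {a, c, e - k, e, e + k, 2 * e}"
    and "0 < k" "k < e" "a < c" "c < 2 * e" "0 \<notin> S" "k \<notin> S" "2 * k \<in> S"
    and "2 * e - a \<notin> S" "2 * e - c \<notin> S" "c - a \<in> S"
    and "\<bar>a - (e - k)\<bar> \<in> S" "\<bar>a - e\<bar> \<in> S" "\<bar>a - (e + k)\<bar> \<in> S"
    and "\<bar>c - (e - k)\<bar> \<in> S" "\<bar>c - e\<bar> \<in> S" "\<bar>c - (e + k)\<bar> \<in> S"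
  shows False
  using assms(2-) unfolding S insert_iff empty_iff
  by (smt (verit))

lemma M6_labelling_centre_not_max:
  assumes "M6_labelling a b c d e f"
    and max: "a \<le> b" "c \<le> b" "d \<le> b" "e \<le> b" "f \<le> b"
  shows False
  using assms
proof (induction a c rule: linorder_wlog)
  case (sym a c)
  then show ?case using M6_labelling_rev by blast
next
  case (le a c)
  from le.prems \<open>a \<le> c\<close> show ?case
  proof (induction d f rule: linorder_wlog)
    case (sym d f)
    \<comment> \<open>Reversing the second path means exchanging the paths, reversing the first, and
      exchanging back.\<close>
    then show ?case using M6_labelling_rev M6_labelling_swap by blast
  next
    case (le d f)
    note max = le.prems(2-6) and ac = le.prems(7) and df = le.hyps
    define S where "S = {a, b, c, d, e, f}"
    have mem: "a \<in> S" "b \<in> S" "c \<in> S" "d \<in> S" "e \<in> S" "f \<in> S"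
      by (auto simp: S_def)
    have le_b: "x \<le> b" if "x \<in> S" for x
      using max that by (auto simp: S_def)
    have adj: "b - d \<in> S" "b - e \<in> S" "b - f \<in> S" "c - a \<in> S" "f - d \<in> S"
        "\<bar>a - d\<bar> \<in> S" "\<bar>a - e\<bar> \<in> S" "\<bar>a - f\<bar> \<in> S" "\<bar>c - d\<bar> \<in> S" "\<bar>c - e\<bar> \<in> S" "\<bar>c - f\<bar> \<in> S"
      and nadj: "b - a \<notin> S" "b - c \<notin> S" "\<bar>d - e\<bar> \<notin> S" "\<bar>e - f\<bar> \<notin> S"
      using le.prems(1) max ac df unfolding M6_labelling_def Let_def S_def[symmetric]
      by (auto simp: abs_minus_commute)
    have nonneg: "0 \<le> d" "0 \<le> e" "0 \<le> f"
      using adj(1-3)[THEN le_b] by auto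
    have nz: "d \<noteq> 0" "e \<noteq> 0" "f \<noteq> 0"
      using nonneg nadj(3,4) mem by auto
    have "a \<noteq> 0" "c \<noteq> 0"
      using nadj(1,2) mem by auto
    then have "0 \<notin> S"
      using nz nonneg max by (auto simp: S_def)
    then have lt: "a < c" "d < f"
      using adj(4,5) ac df by (auto simp: less_le)
    have reflect: "b - x \<in> {d, e, f}" if "x \<in> {d, e, f}" for x
    proof -
      have "b - x \<in> S" "x \<in> S" "x \<noteq> 0"
        using that adj(1-3) mem nz by auto
      moreover have "b - x \<noteq> a" "b - x \<noteq> c"
        using nadj(1,2) \<open>x \<in> S\<close> by auto
      ultimately show ?thesis
        by (simp add: S_def)
    qed
    \<comment> \<open>These inequalities make d, e, f distinct. The reflection reverses their order,
      so they form an arithmetic progression centred at \<open>b / 2\<close>. Were d or f its middle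
      term, one of the excluded equalities would hold; so the middle term is e.\<close>
    have "\<bar>d - e\<bar> \<noteq> f - d" "\<bar>e - f\<bar> \<noteq> f - d"
      using nadj(3,4) adj(5) by auto
    then have b: "b = d + f \<and> b = 2 * e"
      using reflect[of d] reflect[of e] reflect[of f] lt by auto
    define k where "k = e - d"
    have d: "d = e - k" and f: "f = e + k" and be: "b = 2 * e"
      using b by (auto simp: k_def)
    have S: "S = {a, c, e - k, e, e + k, 2 * e}"
      by (auto simp: S_def d f be)
    \<comment> \<open>If c were equal to b, the edge a - c and the non-edge a - b would have the
      same distance.\<close>
    have "c < 2 * e"
      using max(2) be adj(4) nadj(1) by (cases "c = b") auto
    show False
      by (rule no_signature_around_midpoint[OF S])
        (use lt nadj adj nonneg nz \<open>0 \<notin> S\<close> \<open>c < 2 * e\<close> in \<open>simp_all add: d f be\<close>)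
  qed
qed

lemma not_M6_labelling: "\<not> M6_labelling a b c d e f"
proof
  assume abc: "M6_labelling a b c d e f"
  note cba = M6_labelling_rev[OF abc] and def = M6_labelling_swap[OF abc]
  note fed = M6_labelling_rev[OF def]
  let ?S = "{a, b, c, d, e, f}"
  have "Max ?S \<in> ?S" and *: "\<forall>x\<in>?S. x \<le> Max ?S"
    by (rule Max_in) auto
  then consider "Max ?S = a" | "Max ?S = b" | "Max ?S = c" | "Max ?S = d" | "Max ?S = e" | "Max ?S = f"
    by blast
  then show False
  proof cases
    case 1
    with * show False by (intro M6_labelling_end_not_max[OF abc]) simp_all
  next
    case 2
    with * show False by (intro M6_labelling_centre_not_max[OF abc]) simp_all
  next
    case 3
    with * show False by (intro M6_labelling_end_not_max[OF cba]) simp_all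
  next
    case 4
    with * show False by (intro M6_labelling_end_not_max[OF def]) simp_all
  next
    case 5
    with * show False by (intro M6_labelling_centre_not_max[OF def]) simp_all
  next
    case 6
    with * show False by (intro M6_labelling_end_not_max[OF fed]) simp_all
  qed
qed

section \<open>Structure and edge count of M6\<close>

lemma is_path_3E:
  assumes "is_path 3 V E"
  obtains a b c where "V = {a, b, c}" "a \<noteq> b" "b \<noteq> c" "a \<noteq> c" "E = {{a, b}, {b, c}}"
proof -
  obtain p where p: "bij_betw p {..<3} V" "E = {{p i, p (Suc i)} | i. Suc i < 3}"
    using assms by (auto simp: is_path_def)
  have s: "{..<3} = {0, 1, 2 :: nat}"
    by auto
  have "Suc i < 3 \<longleftrightarrow> i = 0 \<or> i = 1" for i
    by auto
  then have "E = {{p 0, p 1}, {p 1, p 2}}"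
    unfolding p(2) by (auto simp: numeral_2_eq_2)
  moreover have "V = {p 0, p 1, p 2}" "p 0 \<noteq> p 1" "p 1 \<noteq> p 2" "p 0 \<noteq> p 2"
    using p(1) by (auto simp: bij_betw_def s inj_on_def)
  ultimately show ?thesis
    using that by blast
qed

lemma is_M6E:
  assumes "is_M6 V E"
  obtains a b c d e f where "V = {a, b, c, d, e, f}" "distinct [a, b, c, d, e, f]"
    "E = {X. X \<subseteq> V \<and> card X = 2} - {{a, b}, {b, c}, {d, e}, {e, f}}"
proof -
  obtain V1 E1 V2 E2 where *: "V1 \<inter> V2 = {}" "V = V1 \<union> V2" "graph_complement V E = E1 \<union> E2"
      "is_path 3 V1 E1" "is_path 3 V2 E2" and E: "\<forall>X\<in>E. X \<subseteq> V \<and> card X = 2"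
    using assms by (auto simp: is_M6_def simple_graph_def)
  obtain a b c where abc: "V1 = {a, b, c}" "a \<noteq> b" "b \<noteq> c" "a \<noteq> c" "E1 = {{a, b}, {b, c}}"
    using *(4) by (rule is_path_3E)
  obtain d e f where def: "V2 = {d, e, f}" "d \<noteq> e" "e \<noteq> f" "d \<noteq> f" "E2 = {{d, e}, {e, f}}"
    using *(5) by (rule is_path_3E)
  have "E = {X. X \<subseteq> V \<and> card X = 2} - graph_complement V E"
    using E by (auto simp: graph_complement_def)
  also have "graph_complement V E = {{a, b}, {b, c}, {d, e}, {e, f}}"
    unfolding *(3) abc(5) def(5) by blast
  finally show ?thesis
    using * abc def by (intro that[of a b c d e f]) auto
qed

lemma card_edges_M6:
  assumes "is_M6 V E"
  shows "card E = 11"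
proof -
  obtain a b c d e f where V: "V = {a, b, c, d, e, f}" and dist: "distinct [a, b, c, d, e, f]"
    and E: "E = {X. X \<subseteq> V \<and> card X = 2} - {{a, b}, {b, c}, {d, e}, {e, f}}"
    using assms by (rule is_M6E)
  have "card {X. X \<subseteq> V \<and> card X = 2} = 15"
    using dist by (subst n_subsets) (simp_all add: V choose_two)
  moreover have "card {{a, b}, {b, c}, {d, e}, {e, f}} = 4"
    using dist by (simp add: doubleton_eq_iff)
  moreover have "{{a, b}, {b, c}, {d, e}, {e, f}} \<subseteq> {X. X \<subseteq> V \<and> card X = 2}"
    using dist by (simp add: V)
  ultimately show ?thesis
    unfolding E by (subst card_Diff_subset) simp_all
qed

lemma not_autograph_M6:
  assumes "is_M6 V E"
  shows "\<not> autograph V E"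
proof
  assume "autograph V E"
  obtain a b c d e f where V: "V = {a, b, c, d, e, f}" and dist: "distinct [a, b, c, d, e, f]"
    and E: "E = {X. X \<subseteq> V \<and> card X = 2} - {{a, b}, {b, c}, {d, e}, {e, f}}"
    using assms by (rule is_M6E)
  have "finite V"
    by (simp add: V)
  obtain x :: "'a \<Rightarrow> int" where
    x: "\<forall>u\<in>V. \<forall>v\<in>V. u \<noteq> v \<longrightarrow> ({u, v} \<in> E \<longleftrightarrow> \<bar>x u - x v\<bar> \<in> x ` V)"
    using \<open>autograph V E\<close> autograph_iff_labelling[OF \<open>finite V\<close>] by blast
  have x': "\<bar>x u - x v\<bar> \<in> x ` V \<longleftrightarrow> {u, v} \<notin> {{a, b}, {b, c}, {d, e}, {e, f}}"
    if "u \<in> V" "v \<in> V" "u \<noteq> v" for u v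
    using x that by (simp add: E)
  have mem: "a \<in> V" "b \<in> V" "c \<in> V" "d \<in> V" "e \<in> V" "f \<in> V"
    by (simp_all add: V)
  have im: "x ` V = {x a, x b, x c, x d, x e, x f}"
    by (simp add: V)
  have "M6_labelling (x a) (x b) (x c) (x d) (x e) (x f)"
    unfolding M6_labelling_def Let_def im[symmetric] using dist
    by (simp add: x' mem doubleton_eq_iff) blast
  then show False
    by (simp add: not_M6_labelling)
qed

section \<open>Graphs with at most five vertices\<close>

text \<open>Graphs are represented as sublists of this fixed list. Equal graphs are then equal
  lists, and \<open>subseqs\<close> enumerates them all.\<close>

definition vertex_pairs :: "nat \<Rightarrow> (nat \<times> nat) list" where
  "vertex_pairs n = [(i, j). j \<leftarrow> [0..<n], i \<leftarrow> [0..<j]]"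

definition edge_list :: "(nat \<Rightarrow> nat \<Rightarrow> bool) \<Rightarrow> nat \<Rightarrow> (nat \<times> nat) list" where
  "edge_list R n = filter (\<lambda>(i, j). R i j) (vertex_pairs n)"

definition difference_edges :: "int list \<Rightarrow> (nat \<times> nat) list" where
  "difference_edges xs = edge_list (\<lambda>i j. \<bar>xs ! i - xs ! j\<bar> \<in> set xs) (length xs)"

text \<open>With \<open>h = Suc\<close> the vertices count as 1, ..., n. Varying \<open>h\<close>
  expresses a renumbering while the edge list stays fixed.\<close>

definition weight :: "(nat \<Rightarrow> nat) \<Rightarrow> (nat \<times> nat) list \<Rightarrow> nat" where
  "weight h es = (\<Sum>(i, j)\<leftarrow>es. h i * h j)"

text \<open>Filtering by one transposition after the other keeps the evaluation below cheap.\<close>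

definition transposition_maximal :: "nat \<Rightarrow> (nat \<times> nat) list list" where
  "transposition_maximal n =
    fold (\<lambda>(a, b). filter (\<lambda>es. weight (\<lambda>i. Suc (transpose a b i)) es \<le> weight Suc es))
      (vertex_pairs n) (subseqs (vertex_pairs n))"

text \<open>Found by exhaustive search over small natural numbers. The \<open>i\<close>-th entry of a list is the label
  of vertex \<open>i\<close>.\<close>

definition signatures :: "int list list" where
  "signatures =
   [[], [0], [0, 0], [1, 1],
    [0, 0, 0], [1, 1, 1], [1, 1, 2], [3, 2, 4],
    [0, 0, 0, 0], [1, 1, 1, 1], [1, 1, 1, 2], [1, 2, 2, 1], [1, 1, 2, 3], [1, 3, 3, 0],
    [3, 2, 2, 4], [3, 3, 2, 4], [3, 4, 5, 2], [5, 2, 4, 6], [3, 6, 4, 8],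
    [0, 0, 0, 0, 0], [1, 1, 1, 1, 1], [1, 1, 1, 1, 2], [1, 1, 2, 1, 2], [1, 1, 2, 2, 1],
    [1, 2, 1, 1, 2], [1, 1, 1, 2, 3], [1, 1, 3, 3, 0], [1, 2, 2, 1, 3], [1, 3, 0, 0, 0],
    [1, 3, 3, 0, 0], [1, 3, 3, 3, 0], [3, 2, 2, 2, 4], [3, 2, 4, 4, 2], [3, 3, 2, 2, 4],
    [3, 3, 3, 2, 4], [1, 3, 5, 5, 0], [3, 1, 1, 5, 4], [3, 2, 4, 5, 2], [3, 3, 4, 5, 2],
    [3, 4, 2, 2, 5], [3, 4, 4, 1, 5], [3, 4, 4, 5, 2], [3, 4, 5, 2, 0], [3, 5, 4, 6, 2],
    [5, 2, 2, 4, 6], [5, 5, 2, 4, 6], [4, 7, 5, 1, 6], [5, 4, 6, 7, 3], [5, 7, 4, 6, 2],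
    [3, 3, 6, 4, 8], [3, 6, 4, 4, 8], [4, 6, 1, 8, 7], [5, 2, 4, 6, 8], [5, 6, 7, 8, 2],
    [5, 7, 6, 2, 8], [1, 2, 9, 4, 8], [3, 7, 1, 9, 8], [4, 8, 3, 6, 9], [7, 4, 8, 5, 10]]"

text \<open>The finite check, over at most 2^10 edge lists for each n: every list that survives the
  filters is realised by a listed signature.\<close>

lemma transposition_maximal_subset_difference_edges:
  "\<forall>n\<in>set [0..<6].
    set (transposition_maximal n) \<subseteq> set (map difference_edges (filter (\<lambda>xs. length xs = n) signatures))"
  by code_simp

section \<open>Renumbering vertices and the weight of edge lists\<close>

lemma set_vertex_pairs: "set (vertex_pairs n) = {(i, j). i < j \<and> j < n}"
  by (auto simp: vertex_pairs_def)

lemma set_edge_list: "(i, j) \<in> set (edge_list R n) \<longleftrightarrow> i < j \<and> j < n \<and> R i j"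
  by (auto simp: edge_list_def set_vertex_pairs)

lemma filter_in_subseqs: "filter P xs \<in> set (subseqs xs)"
  by (induction xs) (auto simp: Let_def)

lemma distinct_vertex_pairs: "distinct (vertex_pairs n)"
proof (induction n)
  case (Suc n)
  have "vertex_pairs (Suc n) = vertex_pairs n @ map (\<lambda>i. (i, n)) [0..<n]"
    by (simp add: vertex_pairs_def)
  with Suc show ?case
    by (auto simp: distinct_map inj_on_def set_vertex_pairs)
qed (simp add: vertex_pairs_def)

lemma weight_edge_list:
  "weight h (edge_list R n) = (\<Sum>(i, j)\<in>{(i, j). i < j \<and> j < n \<and> R i j}. h i * h j)"
proof -
  have "distinct (edge_list R n)"
    by (simp add: edge_list_def distinct_vertex_pairs)
  moreover have "set (edge_list R n) = {(i, j). i < j \<and> j < n \<and> R i j}"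
    by (auto simp: set_edge_list)
  ultimately show ?thesis
    by (simp add: weight_def sum_list_distinct_conv_sum_set)
qed

text \<open>Moves a transposition from the graph to the factors of the sum, which is the form tested
  in \<open>transposition_maximal\<close>.\<close>

lemma weight_edge_list_transpose:
  assumes "\<And>i j. R i j \<longleftrightarrow> R j i" and "a < n" "b < n"
  shows "weight h (edge_list (\<lambda>i j. R (transpose a b i) (transpose a b j)) n)
    = weight (\<lambda>i. h (transpose a b i)) (edge_list R n)"
proof -
  define s where "s = transpose a b"
  have s: "s (s i) = i" "i < n \<Longrightarrow> s i < n" "s i = s j \<longleftrightarrow> i = j" for i j
    using assms(2,3) by (auto simp: s_def transpose_def)
  \<comment> \<open>Edges are stored with the smaller vertex first, so the transposed pair has to be
    sorted again. On such pairs \<open>m\<close> is still an involution.\<close>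
  define m where "m = (\<lambda>(i, j). (min (s i) (s j), max (s i) (s j)))"
  have m: "m (m p) = p" "m p = (s i, s j) \<or> m p = (s j, s i)" "fst (m p) < snd (m p)"
    if "p = (i, j)" "i < j" for p i j
  proof -
    have "s i \<noteq> s j"
      using that s(3) by simp
    with that show "m (m p) = p" "m p = (s i, s j) \<or> m p = (s j, s i)" "fst (m p) < snd (m p)"
      by (auto simp: m_def min_def max_def s(1))
  qed
  have "(\<Sum>(i, j)\<in>{(i, j). i < j \<and> j < n \<and> R (s i) (s j)}. h i * h j)
      = (\<Sum>(i, j)\<in>{(i, j). i < j \<and> j < n \<and> R i j}. h (s i) * h (s j))"
  proof (rule sum.reindex_bij_witness[where i = m and j = m])
    fix p assume "p \<in> {(i, j). i < j \<and> j < n \<and> R (s i) (s j)}"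
    then obtain i j where p: "p = (i, j)" "i < j" "i < n" "j < n" "R (s i) (s j)"
      by auto
    show "m (m p) = p"
      using m p by blast
    show "m p \<in> {(i, j). i < j \<and> j < n \<and> R i j}"
      using m(2,3)[OF p(1,2)] p assms(1) s(2) by auto
    show "(case m p of (i, j) \<Rightarrow> h (s i) * h (s j)) = (case p of (i, j) \<Rightarrow> h i * h j)"
      using m(2)[OF p(1,2)] p(1) by (auto simp: s)
  next
    fix p assume "p \<in> {(i, j). i < j \<and> j < n \<and> R i j}"
    then obtain i j where p: "p = (i, j)" "i < j" "i < n" "j < n" "R i j"
      by auto
    show "m (m p) = p"
      using m p by blast
    show "m p \<in> {(i, j). i < j \<and> j < n \<and> R (s i) (s j)}"
      using m(2,3)[OF p(1,2)] p assms(1) s by auto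
  qed
  then show ?thesis
    by (simp add: weight_edge_list s_def)
qed

lemma set_fold_filter: "set (fold (\<lambda>t. filter (P t)) ts xs) = {x \<in> set xs. \<forall>t\<in>set ts. P t x}"
  by (induction ts arbitrary: xs) auto

lemma set_transposition_maximal:
  "set (transposition_maximal n) = {es \<in> set (subseqs (vertex_pairs n)).
     \<forall>a b. a < b \<and> b < n \<longrightarrow> weight (\<lambda>i. Suc (transpose a b i)) es \<le> weight Suc es}"
proof -
  have "transposition_maximal n =
    fold (\<lambda>t. filter (\<lambda>es. weight (\<lambda>i. Suc (transpose (fst t) (snd t) i)) es \<le> weight Suc es))
      (vertex_pairs n) (subseqs (vertex_pairs n))"
    by (simp add: transposition_maximal_def split_def)
  then show ?thesis
    by (auto simp: set_fold_filter set_vertex_pairs)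
qed

lemma ex_signature_of_transposition_maximal:
  assumes "n \<le> 5" "es \<in> set (transposition_maximal n)"
  shows "\<exists>xs. length xs = n \<and> difference_edges xs = es"
proof -
  have "n \<in> set [0..<6]"
    using assms(1) by simp
  then have "es \<in> set (map difference_edges (filter (\<lambda>xs. length xs = n) signatures))"
    using transposition_maximal_subset_difference_edges assms(2) by blast
  then show ?thesis
    by auto
qed

lemma autograph_if_card_le_5:
  assumes "simple_graph W F" and card: "card W \<le> 5"
  shows "autograph W F"
proof -
  define n where "n = card W"
  have W: "finite W"
    using assms(1) by (simp add: simple_graph_def)
  define edges where "edges f = edge_list (\<lambda>i j. {f i, f j} \<in> F) n" for f
  let ?B = "{f. bij_betw f {..<n} W}"
  \<comment> \<open>The bijections in \<open>?B\<close> are unconstrained outside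
    \<open>{..<n}\<close>, so finiteness comes from their edge lists: these are sublists of
    \<open>vertex_pairs n\<close>.\<close>
  have "range edges \<subseteq> set (subseqs (vertex_pairs n))"
    by (auto simp: edges_def edge_list_def filter_in_subseqs)
  then have fin: "finite (weight Suc ` edges ` ?B)"
    by (meson finite_imageI finite_set finite_subset image_mono subset_UNIV)
  obtain f0 where "bij_betw f0 {..<n} W"
    using ex_bij_betw_nat_finite[OF W] by (auto simp: n_def atLeast0LessThan)
  then have "Max (weight Suc ` edges ` ?B) \<in> weight Suc ` edges ` ?B"
    by (intro Max_in fin) auto
  then obtain f where f: "bij_betw f {..<n} W" and max: "weight Suc (edges f) = Max (weight Suc ` edges ` ?B)"
    by auto
  \<comment> \<open>Composing \<open>f\<close> with a transposition gives another numbering of W,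
    whose weight cannot exceed the maximum.\<close>
  have "weight (\<lambda>i. Suc (transpose a b i)) (edges f) \<le> weight Suc (edges f)" if "a < b" "b < n" for a b
  proof -
    have "bij_betw (transpose a b) {..<n} {..<n}"
      using that by (intro bij_betw_byWitness[where f' = "transpose a b"]) (auto simp: transpose_def)
    then have "bij_betw (f \<circ> transpose a b) {..<n} W"
      using f by (rule bij_betw_trans)
    then have "weight Suc (edges (f \<circ> transpose a b)) \<le> weight Suc (edges f)"
      unfolding max by (intro Max_ge fin) auto
    then show ?thesis
      using weight_edge_list_transpose[of "\<lambda>i j. {f i, f j} \<in> F" a n b Suc] that
      by (simp add: edges_def insert_commute)
  qed
  then have "edges f \<in> set (transposition_maximal n)"
    by (simp add: set_transposition_maximal edges_def edge_list_def filter_in_subseqs)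
  then obtain xs where xs: "length xs = n" "difference_edges xs = edges f"
    using card ex_signature_of_transposition_maximal unfolding n_def by blast
  have adj: "{f i, f j} \<in> F \<longleftrightarrow> \<bar>xs ! i - xs ! j\<bar> \<in> set xs" if "i < j" "j < n" for i j
  proof -
    have "(i, j) \<in> set (edges f) \<longleftrightarrow> (i, j) \<in> set (difference_edges xs)"
      using xs(2) by simp
    then show ?thesis
      using that xs(1) by (simp add: edges_def difference_edges_def set_edge_list)
  qed
  \<comment> \<open>The signature found labels indices; the inverse of the numbering
    \<open>f\<close> carries the labels to W.\<close>
  define x where "x v = xs ! inv_into {..<n} f v" for v
  have x: "x (f i) = xs ! i" if "i < n" for i
    using bij_betw_inv_into_left[OF f] that by (simp add: x_def)
  have W_eq: "W = f ` {..<n}"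
    using bij_betw_imp_surj_on[OF f] by simp
  have "x ` W = set xs"
    using x by (auto simp: W_eq image_image set_conv_nth xs(1))
  moreover have "{f i, f j} \<in> F \<longleftrightarrow> \<bar>xs ! i - xs ! j\<bar> \<in> set xs" if "i < n" "j < n" "i \<noteq> j" for i j
    using adj[of i j] adj[of j i] that by (cases "i < j") (auto simp: insert_commute abs_minus_commute)
  ultimately have "\<forall>u\<in>W. \<forall>v\<in>W. u \<noteq> v \<longrightarrow> ({u, v} \<in> F \<longleftrightarrow> \<bar>x u - x v\<bar> \<in> x ` W)"
    using x unfolding W_eq by auto
  then show ?thesis
    using autograph_iff_labelling[OF W] by blast
qed

theorem theorem1:
  shows "(\<forall>(V :: 'a set) E. is_M6 V E \<longrightarrow> card E = 11 \<and> \<not> autograph V E) \<and>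
    (\<forall>(W :: 'b set) F. simple_graph W F \<and> card W \<le> 5 \<longrightarrow> autograph W F)"
  by (simp add: card_edges_M6 not_autograph_M6 autograph_if_card_le_5)

end
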